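(* Let $(A,\cdot,\circ)$ be a $2$-dimensional transposed Novikov-Poisson algebra over $\mathbb{C}$ with $\circ$ non-zero. Then $(A,\cdot,\circ)$ is isomorphic to one of the following algebras with basis $\{e_1,e_2\}$, given by the characteristic matrices $M_\circ$ of $\circ$ and $M_\cdot$ of $\cdot$, where $m,n\in\mathbb{C}$: (T2) $M_\circ=\begin{pmatrix} 0 & 0 \\ 0 & e_1 \end{pmatrix}$, $M_\cdot=\begin{pmatrix} 0 & m e_1 \\ m e_1 & n e_1+m e_2 \end{pmatrix}$; (T3) $M_\circ=\begin{pmatrix} 0 & 0 \\ -e_1 & 0 \end{pmatrix}$, $M_\cdot=0$; (N1) $M_\circ=\begin{pmatrix} e_1 & 0 \\ 0 & e_2 \end{pmatrix}$, $M_\cdot=\begin{pmatrix} n e_1 & 0 \\ 0 & m e_2 \end{pmatrix}$; (N2) $M_\circ=\begin{pmatrix} 0 & 0 \\ 0 & e_2 \end{pmatrix}$, $M_\cdot=\begin{pmatrix} n e_1 & 0 \\ 0 & m e_2 \end{pmatrix}$; (N3) $M_\circ=\begin{pmatrix} 0 & e_1 \\ e_1 & e_2 \end{pmatrix}$, $M_\cdot=\begin{pmatrix} 0 & n e_1 \\ n e_1 & m e_1+n e_2 \end{pmatrix}$; (N4) $M_\circ=\begin{pmatrix} 0 & e_1 \\ 0 & e_2 \end{pmatrix}$, $M_\cdot=0$; (N5) $M_\circ=\begin{pmatrix} 0 & e_1 \\ 0 & e_1+e_2 \end{pmatrix}$, $M_\cdot=0$; (N6) $M_\circ=\begin{pmatrix}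 0 & e_1 \\ l e_1 & e_2 \end{pmatrix}$ with $l\in\mathbb{C}$, $l\neq0,1$, $M_\cdot=0$.
   Context: The characteristic matrix of a bilinear operation $\ast$ with respect to a basis $\{e_1,e_2\}$ is the $2\times2$ matrix whose $(i,j)$ entry is $e_i\ast e_j$. An isomorphism is a linear bijection preserving both operations. A (left) Novikov algebra $(A,\circ)$ is a vector space with a bilinear operation satisfying $(x\circ y)\circ z=(x\circ z)\circ y$ and $(x\circ y)\circ z-x\circ(y\circ z)=(y\circ x)\circ z-y\circ(x\circ z)$ for all $x,y,z$. A transposed Novikov-Poisson algebra is a triple $(A,\cdot,\circ)$ where $(A,\cdot)$ is a commutative associative algebra (not necessarily unital), $(A,\circ)$ is a Novikov algebra, and for all $x,y,z\in A$: $(x\cdot y)\circ z=(x\cdot z)\circ y$ and $2z\cdot(x\circ y)=(z\cdot x)\circ y+x\circ(z\cdot y)$. *)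

theory Defs
  imports "HOL-Analysis.Analysis"
begin

locale bilinear_operation = vector_space smul
  for smul :: "'f::field \<Rightarrow> 'a::ab_group_add \<Rightarrow> 'a" +
  fixes mul :: "'a \<Rightarrow> 'a \<Rightarrow> 'a"
  assumes linear_left: "Vector_Spaces.linear smul smul (\<lambda>x. mul x y)"
    and linear_right: "Vector_Spaces.linear smul smul (\<lambda>y. mul x y)"

locale commutative_associative_algebra = bilinear_operation smul cdot
  for smul :: "'f::field \<Rightarrow> 'a::ab_group_add \<Rightarrow> 'a" and cdot :: "'a \<Rightarrow> 'a \<Rightarrow> 'a" +
  assumes commutative: "cdot x y = cdot y x"
    and associative: "cdot (cdot x y) z = cdot x (cdot y z)"

locale novikov_algebra = bilinear_operation smul circ
  for smul :: "'f::field \<Rightarrow> 'a::ab_group_add \<Rightarrow> 'a" and circ :: "'a \<Rightarrow> 'a \<Rightarrow> 'a" +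
  assumes right_commutative: "circ (circ x y) z = circ (circ x z) y"
    and left_symmetric:
      "circ (circ x y) z - circ x (circ y z) = circ (circ y x) z - circ y (circ x z)"

locale transposed_novikov_poisson_algebra =
  dot: commutative_associative_algebra smul cdot + circ: novikov_algebra smul circ
  for smul :: "'f::field \<Rightarrow> 'a::ab_group_add \<Rightarrow> 'a"
    and cdot :: "'a \<Rightarrow> 'a \<Rightarrow> 'a" and circ :: "'a \<Rightarrow> 'a \<Rightarrow> 'a" +
  assumes dot_circ: "circ (cdot x y) z = circ (cdot x z) y"
    and transposed_leibniz:
      "smul 2 (cdot z (circ x y)) = circ (cdot z x) y + circ x (cdot z y)"

definition isomorphic_algebras ::
  "('f::field \<Rightarrow> 'a::ab_group_add \<Rightarrow> 'a) \<Rightarrow> ('a \<Rightarrow> 'a \<Rightarrow> 'a) \<Rightarrow> ('a \<Rightarrow> 'a \<Rightarrow> 'a) \<Rightarrow>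
   ('f \<Rightarrow> 'b::ab_group_add \<Rightarrow> 'b) \<Rightarrow> ('b \<Rightarrow> 'b \<Rightarrow> 'b) \<Rightarrow> ('b \<Rightarrow> 'b \<Rightarrow> 'b) \<Rightarrow> bool"
  where
  "isomorphic_algebras smul cdot circ smul' cdot' circ' \<longleftrightarrow>
    (\<exists>f. Vector_Spaces.linear smul smul' f \<and> bij f \<and>
         (\<forall>x y. f (cdot x y) = cdot' (f x) (f y)) \<and>
         (\<forall>x y. f (circ x y) = circ' (f x) (f y)))"

definition characteristic_matrix :: "('a \<Rightarrow> 'a \<Rightarrow> 'a) \<Rightarrow> ('n::finite \<Rightarrow> 'a) \<Rightarrow> 'a ^ 'n ^ 'n"
  where "characteristic_matrix mul e = (\<chi> i j. mul (e i) (e j))"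

text \<open>The bilinear operation on column vectors whose characteristic matrix with respect to the
  standard basis is \<open>M\<close>. The entries of \<open>M\<close> are themselves vectors.\<close>

definition operation_of_matrix ::
  "('f::field ^ 'n) ^ 'n ^ 'n \<Rightarrow> 'f ^ 'n \<Rightarrow> 'f ^ 'n \<Rightarrow> 'f ^ 'n" where
  "operation_of_matrix M x y = (\<Sum>i\<in>UNIV. \<Sum>j\<in>UNIV. (x $ i * y $ j) *s (M $ i $ j))"

lemma bilinear_operation_of_matrix:
  "bilinear_operation (*s) (operation_of_matrix M)"
  by unfold_locales
    (auto simp: operation_of_matrix_def vec_eq_iff algebra_simps sum.distrib sum_distrib_left)

lemma characteristic_matrix_operation_of_matrix:
  "characteristic_matrix (operation_of_matrix M) (\<lambda>i. axis i 1) = M"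
proof -
  have scale_if: "(if b then 1 else 0) *s v = (if b then v else 0)" for b and v :: "'a ^ 'b"
    by simp
  have "operation_of_matrix M (axis i 1) (axis j 1) =
      (\<Sum>k\<in>UNIV. if k = i then (\<Sum>l\<in>UNIV. if l = j then M $ k $ l else 0) else 0)" for i j
    unfolding operation_of_matrix_def
    by (intro sum.cong refl) (auto simp: axis_def scale_if)
  then show ?thesis by (simp add: characteristic_matrix_def vec_eq_iff)
qed

abbreviation e1 :: "complex ^ 2" where "e1 \<equiv> axis 1 1"
abbreviation e2 :: "complex ^ 2" where "e2 \<equiv> axis 2 1"

definition matrix2 :: "'a::zero \<Rightarrow> 'a \<Rightarrow> 'a \<Rightarrow> 'a \<Rightarrow> 'a ^ 2 ^ 2" where
  "matrix2 a b c d = vector [vector [a, b], vector [c, d]]"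

text \<open>The matrix of \<open>circ\<close> precedes that of \<open>cdot\<close>, in contrast to the order of the operations.\<close>

definition isomorphic_to_matrices ::
  "(complex \<Rightarrow> 'a::ab_group_add \<Rightarrow> 'a) \<Rightarrow> ('a \<Rightarrow> 'a \<Rightarrow> 'a) \<Rightarrow> ('a \<Rightarrow> 'a \<Rightarrow> 'a) \<Rightarrow>
   (complex ^ 2) ^ 2 ^ 2 \<Rightarrow> (complex ^ 2) ^ 2 ^ 2 \<Rightarrow> bool" where
  "isomorphic_to_matrices smul cdot circ M_circ M_cdot \<longleftrightarrow>
    isomorphic_algebras smul cdot circ
      (*s) (operation_of_matrix M_cdot) (operation_of_matrix M_circ)"

end

theory Submission imports Defs begin

text \<open>All right multiplications of a Novikov algebra commute, so over the complex numbers
  they have a common eigenvector \<open>u\<close> (\<open>common_eigenvector\<close>). Completing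
  \<open>u\<close> to a basis \<open>u\<close>, \<open>v\<close> of the plane leaves six structure
  constants for \<open>circ\<close>, and the Novikov identities imply five quadratic equations
  between them (\<open>triangular_table\<close>). These are so degenerate that a short case
  distinction solves them, and in each case an explicit change of basis brings a non-zero
  \<open>circ\<close> to one of the listed tables (\<open>normal_forms\<close>).

  Once \<open>circ\<close> has a normal form, both compatibility conditions are linear in the
  structure constants of \<open>cdot\<close>. Evaluated on basis vectors they force
  \<open>cdot\<close> into the stated shape: this is the content of the lemmas
  \<open>dot_of_T2\<close> to \<open>dot_of_N5\<close>. Finally, a basis in which both tables are
  known is the same as an isomorphism to the algebra of column vectors with these characteristic
  matrices (\<open>isomorphic_to_matricesI\<close>).\<close>

section \<open>A plane and its frames\<close>

text \<open>A frame is an ordered basis of a plane, in the form in which the coordinate map is a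
  bijection. Two-dimensionality enters the classification only through the existence of a frame.\<close>

locale framed_space = vector_space smul
  for smul :: "'f::field \<Rightarrow> 'a::ab_group_add \<Rightarrow> 'a"
begin

definition combo :: "'a \<Rightarrow> 'a \<Rightarrow> 'f \<Rightarrow> 'f \<Rightarrow> 'a" where
  "combo u v a b = smul a u + smul b v"

definition frame :: "'a \<Rightarrow> 'a \<Rightarrow> bool" where
  "frame u v \<longleftrightarrow> bij (\<lambda>(a, b). combo u v a b)"

lemma combo_add: "combo u v a b + combo u v c d = combo u v (a + c) (b + d)"
  by (simp add: combo_def algebra_simps)

lemma combo_diff: "combo u v a b - combo u v c d = combo u v (a - c) (b - d)"
  by (simp add: combo_def algebra_simps)

lemma combo_minus: "- combo u v a b = combo u v (- a) (- b)"
  by (simp add: combo_def algebra_simps)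

lemma combo_scale: "smul k (combo u v a b) = combo u v (k * a) (k * b)"
  by (simp add: combo_def algebra_simps)

lemma zero_combo: "0 = combo u v 0 0" and fst_combo: "u = combo u v 1 0"
  by (simp_all add: combo_def)

text \<open>The composition law for changes of frame.\<close>

lemma combo_combo:
  "combo (combo u v a b) (combo u v c d) s t = combo u v (s * a + t * c) (s * b + t * d)"
  by (simp add: combo_def algebra_simps)

lemma frame_eq_iff:
  assumes "frame u v"
  shows "combo u v a b = combo u v c d \<longleftrightarrow> a = c \<and> b = d"
  using assms by (auto simp: frame_def bij_def inj_def)

lemma frame_obtain:
  assumes "frame u v"
  obtains a b where "x = combo u v a b"
  using assms unfolding frame_def by (metis bij_pointE case_prod_conv surj_pair)

lemma frameI:
  assumes "\<And>x. \<exists>a b. x = combo u v a b"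
    and "\<And>a b. combo u v a b = 0 \<Longrightarrow> a = 0 \<and> b = 0"
  shows "frame u v"
  unfolding frame_def
proof (rule bijI)
  show "inj (\<lambda>(a, b). combo u v a b)"
  proof (rule injI, clarify)
    fix a b c d
    assume "combo u v a b = combo u v c d"
    then have "combo u v (a - c) (b - d) = 0"
      by (simp flip: combo_diff)
    then show "a = c \<and> b = d"
      using assms(2) by force
  qed
  show "surj (\<lambda>(a, b). combo u v a b)"
    using assms(1) by (force simp: surj_def)
qed

text \<open>Cramer's rule inverts the change of coordinates.\<close>

lemma frame_change:
  assumes uv: "frame u v" and det: "a * d - b * c \<noteq> 0"
  shows "frame (combo u v a b) (combo u v c d)"
proof (rule frameI)
  fix x
  obtain p q where x: "x = combo u v p q"
    using uv by (rule frame_obtain)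
  let ?D = "a * d - b * c"
  have "(p * d - q * c) / ?D * a + (q * a - p * b) / ?D * c = p"
       "(p * d - q * c) / ?D * b + (q * a - p * b) / ?D * d = q"
    using det by (simp_all add: divide_simps) (simp_all add: algebra_simps)
  then show "\<exists>s t. x = combo (combo u v a b) (combo u v c d) s t"
    unfolding x combo_combo by metis
next
  fix s t
  assume "combo (combo u v a b) (combo u v c d) s t = 0"
  then have *: "s * a + t * c = 0" "s * b + t * d = 0"
    using frame_eq_iff[OF uv] by (simp_all add: combo_combo zero_combo[of u v])
  have "s * (a * d - b * c) = (s * a + t * c) * d - (s * b + t * d) * c"
    "t * (a * d - b * c) = (s * b + t * d) * a - (s * a + t * c) * b"
    by (simp_all add: algebra_simps)
  then show "s = 0 \<and> t = 0"
    using det * by simp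
qed

lemma frame_of_noncollinear:
  assumes pq: "frame p q" and nc: "x \<noteq> 0" "\<And>k. y \<noteq> smul k x"
  shows "frame x y"
proof -
  obtain a b where x: "x = combo p q a b" using pq by (rule frame_obtain)
  obtain c d where y: "y = combo p q c d" using pq by (rule frame_obtain)
  have "a * d - b * c \<noteq> 0"
  proof
    assume *: "a * d - b * c = 0"
    show False
    proof (cases "a = 0")
      case True
      with nc(1) have "b \<noteq> 0" by (auto simp: x combo_def)
      with * True have "y = smul (d / b) x" by (simp add: x y combo_scale)
      with nc(2) show False by blast
    next
      case False
      with * have "c / a * b = d" by (simp add: field_simps)
      with False have "y = smul (c / a) x" by (simp add: x y combo_scale)
      with nc(2) show False by blast
    qed
  qed
  then show ?thesis unfolding x y by (rule frame_change[OF pq])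
qed

lemma frame_exists:
  assumes "dim (UNIV :: 'a set) = 2"
  obtains u v where "frame u v"
proof -
  obtain B where B: "independent B" "span B = UNIV" "card B = 2"
    using basis_exists[of UNIV] assms by (metis UNIV_I subsetI subset_antisym)
  then obtain u v where uv: "B = {u, v}" "u \<noteq> v"
    by (meson card_2_iff)
  have ind: "u \<notin> span {v}" "v \<noteq> 0"
    using B(1) uv by (auto simp: independent_insert dependent_zero)
  have "frame u v"
  proof (rule frameI)
    fix x
    have "x \<in> span {u, v}" using B uv by auto
    then obtain k where "x - smul k u \<in> span {v}"
      using span_breakdown_eq by blast
    then obtain l where "x - smul k u = smul l v"
      by (auto simp: span_singleton)
    then show "\<exists>a b. x = combo u v a b"
      unfolding combo_def by (metis add.commute diff_add_cancel)
  next
    fix a b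
    assume *: "combo u v a b = 0"
    have "a = 0"
    proof (rule ccontr)
      assume a: "a \<noteq> 0"
      from * have "smul a u = smul (- b) v"
        by (simp add: combo_def eq_neg_iff_add_eq_0)
      then have "smul (1 / a) (smul a u) = smul (1 / a) (smul (- b) v)" by simp
      with a have "u = smul (- b / a) v" by simp
      with ind(1) show False by (metis span_base span_scale singletonI)
    qed
    with * ind(2) show "a = 0 \<and> b = 0" by (simp add: combo_def)
  qed
  then show ?thesis by (rule that)
qed

end

section \<open>Multiplication tables\<close>

text \<open>The entries are read row by row, as in a characteristic matrix, but they are terms in
  \<open>u\<close> and \<open>v\<close>: normal forms are most readable in this way.\<close>

definition table :: "('a \<Rightarrow> 'a \<Rightarrow> 'b) \<Rightarrow> 'a \<Rightarrow> 'a \<Rightarrow> 'b \<Rightarrow> 'b \<Rightarrow> 'b \<Rightarrow> 'b \<Rightarrow> bool" where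
  "table mul u v uu uv vu vv \<longleftrightarrow>
     mul u u = uu \<and> mul u v = uv \<and> mul v u = vu \<and> mul v v = vv"

sublocale bilinear_operation \<subseteq> framed_space smul ..

context bilinear_operation
begin

lemma mul_add_left: "mul (x + y) z = mul x z + mul y z"
  and mul_scale_left: "mul (smul k x) z = smul k (mul x z)"
  and mul_add_right: "mul z (x + y) = mul z x + mul z y"
  and mul_scale_right: "mul z (smul k x) = smul k (mul z x)"
  using linear_left linear_right by (simp_all add: Vector_Spaces.linear_iff)

text \<open>With this rule, an identity in the algebra becomes a pair of polynomial identities
  between the structure constants.\<close>

lemma mul_combo:
  assumes "table mul u v (combo u v p1 q1) (combo u v p2 q2) (combo u v p3 q3) (combo u v p4 q4)"
  shows "mul (combo u v a b) (combo u v c d) =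
    combo u v (a * c * p1 + a * d * p2 + b * c * p3 + b * d * p4)
              (a * c * q1 + a * d * q2 + b * c * q3 + b * d * q4)"
proof -
  have "mul (combo u v a b) (combo u v c d) =
    smul (a * c) (mul u u) + smul (a * d) (mul u v) + smul (b * c) (mul v u) + smul (b * d) (mul v v)"
    unfolding combo_def mul_add_left mul_add_right mul_scale_left mul_scale_right
    by (simp add: algebra_simps)
  also have "\<dots> = combo u v (a * c * p1 + a * d * p2 + b * c * p3 + b * d * p4)
              (a * c * q1 + a * d * q2 + b * c * q3 + b * d * q4)"
    using assms by (simp add: table_def combo_scale combo_add)
  finally show ?thesis .
qed

lemma zero_left: "mul 0 z = 0"
  using mul_scale_left[of 0 0 z] by simp

end

section \<open>Novikov algebras on a complex plane\<close>

text \<open>The classification uses the algebraic closedness of the scalars only here, for the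
  eigenvalue of an operator on the plane.\<close>

lemma complex_quadratic_root:
  fixes s t :: complex
  obtains c where "c * c + t * c = s"
proof -
  let ?r = "csqrt (t\<^sup>2 / 4 + s)"
  have "(?r - t / 2) * (?r - t / 2) + t * (?r - t / 2) = ?r\<^sup>2 - t\<^sup>2 / 4"
    by (simp add: field_simps power2_eq_square del: power2_csqrt)
  then show ?thesis using that by simp
qed

locale complex_novikov_algebra = novikov_algebra smul circ
  for smul :: "complex \<Rightarrow> 'a::ab_group_add \<Rightarrow> 'a" and circ :: "'a \<Rightarrow> 'a \<Rightarrow> 'a"
begin

text \<open>Right commutativity says that the operators \<open>x \<mapsto> circ x z\<close>
  commute. If one of them is not a scalar, then on a plane it has an eigenvector \<open>u\<close>
  whose eigenspace is a line; every operator that commutes with it preserves that line. The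
  eigenvector is found in a cyclic frame \<open>v\<close>, \<open>w = circ v y\<close>, where the
  operator is a companion matrix: \<open>w + c v\<close> is an eigenvector as soon as
  \<open>c\<close> solves a quadratic equation, and its eigenvalue is then \<open>t + c\<close>.\<close>

lemma common_eigenvector:
  assumes pq: "frame p q"
  obtains u v where "frame u v" "\<And>z. \<exists>k. circ u z = smul k u"
proof (cases "\<forall>x y. \<exists>k. circ x y = smul k x")
  case True
  with pq that show thesis by blast
next
  case False
  then obtain v y where nc: "\<And>k. circ v y \<noteq> smul k v" by blast
  define w where "w = circ v y"
  have "v \<noteq> 0" using nc[of 0] zero_left by auto
  then have vw: "frame v w"
    using frame_of_noncollinear[OF pq] nc unfolding w_def by blast
  obtain s t where st: "circ w y = combo v w s t"
    using vw by (rule frame_obtain)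
  obtain c where c: "c * c + t * c = s"
    by (rule complex_quadratic_root)
  define u where "u = combo v w c 1"
  have uv: "frame u v"
    using frame_change[OF vw, of c 0 1 1] unfolding u_def
    by (simp flip: fst_combo)
  have Ru: "circ u y = smul (t + c) u"
    unfolding u_def combo_scale
    by (simp add: combo_def mul_add_left mul_scale_left st algebra_simps flip: w_def c)
  have Rv: "circ v y = combo u v 1 (- c)"
    unfolding w_def[symmetric] u_def by (simp add: combo_def)
  \<comment> \<open>The coefficient 1 in \<open>Rv\<close> makes the eigenspace of \<open>u\<close> a line, whether or not the two
    eigenvalues \<open>t + c\<close> and \<open>- c\<close> coincide; this is what forces \<open>m = 0\<close>.\<close>
  have "\<exists>k. circ u z = smul k u" for z
  proof -
    obtain k m where km: "circ u z = combo u v k m"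
      using uv by (rule frame_obtain)
    have "circ (circ u z) y = combo u v (k * (t + c) + m) (- m * c)"
      unfolding km combo_def[of u v k m] mul_add_left mul_scale_left Ru Rv
      by (simp add: combo_def algebra_simps)
    moreover have "circ (circ u y) z = combo u v ((t + c) * k) ((t + c) * m)"
      by (simp add: Ru mul_scale_left km combo_scale)
    ultimately have "k * (t + c) + m = (t + c) * k"
      using right_commutative[of u y z] frame_eq_iff[OF uv] by simp
    then have "m = 0" by (simp add: mult.commute)
    with km have "circ u z = smul k u" by (simp add: combo_def)
    then show ?thesis ..
  qed
  with uv that show thesis by blast
qed

text \<open>In a frame that starts with a common eigenvector, the first row of the table consists
  of multiples of \<open>u\<close>, so that all right multiplications are triangular. The first
  equation is right commutativity at \<open>v\<close>; the others are the two coordinates of left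
  symmetry for the pair \<open>u\<close>, \<open>v\<close> acting on \<open>u\<close> and on
  \<open>v\<close>.\<close>

lemma triangular_table:
  assumes pq: "frame p q"
  obtains u v a b c d f g where "frame u v"
    and "table circ u v (combo u v a 0) (combo u v b 0) (combo u v c d) (combo u v f g)"
    and "(a - d) * f = (b - g) * c" "d * (d - a) = 0" "b * (a - d) = c * (a + d)"
      "d * (g - b) = 0" "b * (b - g) = f * (a + d)"
proof -
  obtain u v where uv: "frame u v" and eig: "\<And>z. \<exists>k. circ u z = smul k u"
    using common_eigenvector[OF pq] by blast
  obtain a b where ab: "circ u u = combo u v a 0" "circ u v = combo u v b 0"
    using eig[of u] eig[of v] by (auto simp: combo_def)
  obtain c d where cd: "circ v u = combo u v c d" using uv by (rule frame_obtain)
  obtain f g where fg: "circ v v = combo u v f g" using uv by (rule frame_obtain)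
  have T: "table circ u v (combo u v a 0) (combo u v b 0) (combo u v c d) (combo u v f g)"
    using ab cd fg by (simp add: table_def)
  note compute = mul_combo[OF T] combo_diff frame_eq_iff[OF uv]
  have 1: "c * b + d * f = f * a + g * c"
    using right_commutative[of "combo u v 0 1" "combo u v 1 0" "combo u v 0 1"]
    by (simp add: compute)
  have 2: "b * a - (c * a + d * b) = c * a + d * c - a * c" "d * d - a * d = 0"
    using left_symmetric[of "combo u v 1 0" "combo u v 0 1" "combo u v 1 0"]
    by (simp_all add: compute)
  have 3: "b * b - (f * a + g * b) = c * b + d * f - b * c" "d * g - b * d = 0"
    using left_symmetric[of "combo u v 1 0" "combo u v 0 1" "combo u v 0 1"]
    by (simp_all add: compute)
  show thesis
    using 1 2 3 by (intro that[OF uv T]) (auto simp: algebra_simps)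
qed

text \<open>The second equation of the triangular table gives \<open>d = 0\<close> or
  \<open>d = a\<close>. If \<open>d \<noteq> 0\<close>, all right multiplications are scalars, and it suffices to choose
  \<open>u\<close> acting as zero and \<open>v\<close> acting as the identity. If \<open>d = 0\<close> and \<open>a \<noteq> 0\<close>, then \<open>u\<close> is a multiple of an idempotent, and subtracting a
  multiple of \<open>u\<close> from \<open>v\<close> makes the algebra a direct sum of two lines.
  If \<open>d = a = 0\<close> and \<open>b \<noteq> g\<close>, only \<open>circ v v\<close> is
  non-zero and it spans an idempotent line. In the remaining case \<open>b = g\<close>, so right
  multiplication by \<open>v\<close> has a double eigenvalue: it is nilpotent in T2 and T3, and
  invertible in the rest. There the ratio \<open>c / b\<close> is the parameter \<open>l\<close>,
  and the \<open>u\<close>-component of \<open>circ v v\<close> can be removed by shearing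
  \<open>v\<close> unless \<open>l = 0\<close>.

  The case name N346 stands for the family that contains N3 (\<open>l = 1\<close>), N4 (\<open>l = 0\<close>) and N6.\<close>

lemma normal_forms:
  assumes pq: "frame p q" and nonzero: "\<exists>x y. circ x y \<noteq> 0"
  obtains (T2) u v where "frame u v" "table circ u v 0 0 0 u"
  | (T3) u v where "frame u v" "table circ u v 0 0 (- u) 0"
  | (N1) u v where "frame u v" "table circ u v u 0 0 v"
  | (N2) u v where "frame u v" "table circ u v 0 0 0 v"
  | (N346) u v l where "frame u v" "table circ u v 0 u (smul l u) v"
  | (N5) u v where "frame u v" "table circ u v 0 u 0 (u + v)"
proof -
  obtain u v a b c d f g where uv: "frame u v"
    and T: "table circ u v (combo u v a 0) (combo u v b 0) (combo u v c d) (combo u v f g)"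
    and eqs: "(a - d) * f = (b - g) * c" "d * (d - a) = 0" "b * (a - d) = c * (a + d)"
      "d * (g - b) = 0" "b * (b - g) = f * (a + d)"
    using pq by (rule triangular_table)
  note compute = table_def mul_combo[OF T] combo_add combo_diff combo_scale combo_minus
    zero_combo[of u v] frame_eq_iff[OF uv]
  consider "d \<noteq> 0" | "d = 0" "a \<noteq> 0" | "d = 0" "a = 0" "b \<noteq> g"
    | "d = 0" "a = 0" "b = g" "b = 0"
    | "d = 0" "a = 0" "b = g" "b \<noteq> 0" by blast
  then show thesis
  proof cases
    case 1
    with eqs have eq: "a = d" "b = g" "c = 0" "f = 0" by auto
    show thesis
    proof (rule N346)
      show "frame (combo u v (- b) d) (combo u v (1 / d) 0)"
        using uv by (rule frame_change) (use 1 in simp)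
      show "table circ (combo u v (- b) d) (combo u v (1 / d) 0) 0 (combo u v (- b) d)
          (smul 0 (combo u v (- b) d)) (combo u v (1 / d) 0)"
        using 1 by (simp add: compute eq)
    qed
  next
    case 2
    with eqs have eq: "d = 0" "c = b" and f: "f = b * (b - g) / a"
      by (auto simp: field_simps)
    \<comment> \<open>The vector \<open>u / a\<close> is idempotent, and \<open>v - (b / a) u\<close>, which it annihilates from both sides,
      has the square \<open>g\<close> times itself: N1 or N2 according to whether \<open>g\<close> can be scaled to 1.\<close>
    show thesis
    proof (cases "g = 0")
      case True
      show thesis
      proof (rule N2)
        show "frame (combo u v (- b / a) 1) (combo u v (1 / a) 0)"
          using uv by (rule frame_change) (use 2 in simp)
        show "table circ (combo u v (- b / a) 1) (combo u v (1 / a) 0) 0 0 0 (combo u v (1 / a) 0)"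
          using 2 True by (simp add: compute eq f)
      qed
    next
      case False
      show thesis
      proof (rule N1)
        show "frame (combo u v (1 / a) 0) (combo u v (- b / (a * g)) (1 / g))"
          using uv by (rule frame_change) (use 2 False in simp)
        show "table circ (combo u v (1 / a) 0) (combo u v (- b / (a * g)) (1 / g))
            (combo u v (1 / a) 0) 0 0 (combo u v (- b / (a * g)) (1 / g))"
          using 2 False by (simp add: compute eq f field_simps)
      qed
    qed
  next
    case 3
    with eqs have eq: "c = 0" "b = 0" and g: "g \<noteq> 0" by auto
    \<comment> \<open>The idempotent is \<open>circ v v / g\<^sup>2\<close>.\<close>
    show thesis
    proof (rule N2)
      show "frame (combo u v 1 0) (combo u v (f / (g * g)) (1 / g))"
        using uv by (rule frame_change) (use g in simp)
      show "table circ (combo u v 1 0) (combo u v (f / (g * g)) (1 / g)) 0 0 0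
          (combo u v (f / (g * g)) (1 / g))"
        using 3 g by (simp add: compute eq)
    qed
  next
    case 4
    show thesis
    proof (cases "c = 0")
      case True
      have f: "f \<noteq> 0"
      proof
        assume "f = 0"
        have "circ x y = 0" for x y
        proof -
          obtain s t where x: "x = combo u v s t" using uv by (rule frame_obtain)
          obtain s' t' where y: "y = combo u v s' t'" using uv by (rule frame_obtain)
          from 4 True \<open>f = 0\<close> show ?thesis by (simp add: x y compute)
        qed
        with nonzero show False by blast
      qed
      show thesis
      proof (rule T2)
        show "frame (combo u v f 0) (combo u v 0 1)"
          using uv by (rule frame_change) (use f in simp)
        show "table circ (combo u v f 0) (combo u v 0 1) 0 0 0 (combo u v f 0)"
          using 4 True by (simp add: compute)
      qed
    next
      case False
      \<comment> \<open>Since \<open>circ v u = c u\<close>, subtracting \<open>(f / c) u\<close> from \<open>v\<close> makes its square vanish.\<close>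
      show thesis
      proof (rule T3)
        show "frame (combo u v 1 0) (combo u v (f / (c * c)) (- 1 / c))"
          using uv by (rule frame_change) (use False in simp)
        show "table circ (combo u v 1 0) (combo u v (f / (c * c)) (- 1 / c))
            0 0 (- combo u v 1 0) 0"
          using 4 False by (simp add: compute)
      qed
    qed
  next
    case 5
    show thesis
    proof (cases "c = 0 \<and> f \<noteq> 0")
      case True
      show thesis
      proof (rule N5)
        show "frame (combo u v (f / (b * b)) 0) (combo u v 0 (1 / b))"
          using uv by (rule frame_change) (use 5 True in simp)
        show "table circ (combo u v (f / (b * b)) 0) (combo u v 0 (1 / b)) 0
            (combo u v (f / (b * b)) 0) 0 (combo u v (f / (b * b)) 0 + combo u v 0 (1 / b))"
          using 5 True by (simp add: compute)
      qed
    next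
      case False
      \<comment> \<open>Replacing \<open>v / b\<close> by \<open>t u + v / b\<close> adds \<open>t (1 + c / b) u\<close> to its square; the square is again
        the vector itself if \<open>t c / b = - f / b\<^sup>2\<close>. For \<open>c = f = 0\<close> division by zero gives the
        correct value \<open>t = 0\<close>.\<close>
      define t where "t = - f / (b * c)"
      have "t * c * b + f = 0" using False 5 by (auto simp: t_def)
      then have t: "f = - t * c * b" by (simp add: add_eq_0_iff)
      show thesis
      proof (rule N346)
        show "frame (combo u v 1 0) (combo u v t (1 / b))"
          using uv by (rule frame_change) (use 5 in simp)
        show "table circ (combo u v 1 0) (combo u v t (1 / b)) 0 (combo u v 1 0)
            (smul (c / b) (combo u v 1 0)) (combo u v t (1 / b))"
          using 5 by (simp add: compute t field_simps)
      qed
    qed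
  qed
qed

end

section \<open>Compatible commutative products\<close>

locale complex_transposed_novikov_poisson_algebra = complex_novikov_algebra smul circ +
    transposed_novikov_poisson_algebra smul cdot circ
  for smul :: "complex \<Rightarrow> 'a::ab_group_add \<Rightarrow> 'a" and cdot circ :: "'a \<Rightarrow> 'a \<Rightarrow> 'a"
begin

lemma dot_table:
  assumes "frame u v"
  obtains a b c d f g where
    "table cdot u v (combo u v a b) (combo u v c d) (combo u v c d) (combo u v f g)"
  using assms dot.commutative[of u v] unfolding table_def by (metis frame_obtain)

text \<open>Here \<open>circ\<close> sees only the \<open>v\<close>-coordinates of its arguments,
  so exchanging \<open>u\<close> and \<open>v\<close> in \<open>dot_circ\<close> shows that
  \<open>cdot x u\<close> is a multiple of \<open>u\<close>. The transposed Leibniz rule for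
  \<open>circ v v = u\<close> says that \<open>cdot z u\<close> is the \<open>v\<close>-coordinate
  of \<open>cdot z v\<close> times \<open>u\<close>.\<close>

lemma dot_of_T2:
  assumes uv: "frame u v" and T: "table circ u v 0 0 0 u"
  obtains m n where "table cdot u v 0 (smul m u) (smul m u) (smul n u + smul m v)"
proof -
  have C: "table circ u v (combo u v 0 0) (combo u v 0 0) (combo u v 0 0) (combo u v 1 0)"
    using T by (simp add: table_def combo_def)
  obtain a b c d f g where D:
    "table cdot u v (combo u v a b) (combo u v c d) (combo u v c d) (combo u v f g)"
    using uv by (rule dot_table)
  note compute = mul_combo[OF C] dot.mul_combo[OF D] combo_add combo_scale frame_eq_iff[OF uv]
  have "b = 0"
    using dot_circ[of "combo u v 1 0" "combo u v 1 0" "combo u v 0 1"] by (simp add: compute)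
  moreover have "d = 0"
    using dot_circ[of "combo u v 0 1" "combo u v 1 0" "combo u v 0 1"] by (simp add: compute)
  moreover have "a = d"
    using transposed_leibniz[of "combo u v 1 0" "combo u v 0 1" "combo u v 0 1"]
    by (simp add: compute)
  moreover have "c = g"
    using transposed_leibniz[of "combo u v 0 1" "combo u v 0 1" "combo u v 0 1"]
    by (simp add: compute)
  ultimately have "table cdot u v 0 (smul g u) (smul g u) (smul f u + smul g v)"
    using D by (simp add: table_def combo_def)
  then show thesis by (rule that)
qed

text \<open>Exchanging \<open>u\<close> and \<open>v\<close> in \<open>dot_circ\<close> confines
  \<open>cdot x v\<close> to the line of \<open>u\<close>. The transposed Leibniz rule for
  \<open>circ v u = - u\<close> then compares \<open>cdot z u\<close> with its double, and for
  \<open>circ v v = 0\<close> it kills \<open>cdot v v\<close>.\<close>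

lemma dot_of_T3:
  assumes uv: "frame u v" and T: "table circ u v 0 0 (- u) 0"
  shows "table cdot u v 0 0 0 0"
proof -
  have C: "table circ u v (combo u v 0 0) (combo u v 0 0) (combo u v (-1) 0) (combo u v 0 0)"
    using T by (simp add: table_def combo_def)
  obtain a b c d f g where D:
    "table cdot u v (combo u v a b) (combo u v c d) (combo u v c d) (combo u v f g)"
    using uv by (rule dot_table)
  note compute = mul_combo[OF C] dot.mul_combo[OF D] combo_add combo_scale frame_eq_iff[OF uv]
  have dg: "d = 0" "g = 0"
    using dot_circ[of "combo u v 1 0" "combo u v 1 0" "combo u v 0 1"]
      dot_circ[of "combo u v 0 1" "combo u v 1 0" "combo u v 0 1"] by (simp_all add: compute)
  have "a = 0" "b = 0"
    using transposed_leibniz[of "combo u v 1 0" "combo u v 0 1" "combo u v 1 0"] dg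
    by (simp_all add: compute)
  moreover have "c = 0"
    using transposed_leibniz[of "combo u v 0 1" "combo u v 0 1" "combo u v 1 0"] dg
    by (simp add: compute)
  moreover have "f = 0"
    using transposed_leibniz[of "combo u v 0 1" "combo u v 0 1" "combo u v 0 1"] dg
    by (simp add: compute)
  ultimately show ?thesis
    using D dg by (simp add: table_def combo_def)
qed

text \<open>Right multiplications by \<open>u\<close> and \<open>v\<close> project onto different
  lines, so \<open>dot_circ\<close> alone decouples the two lines.\<close>

lemma dot_of_N1:
  assumes uv: "frame u v" and T: "table circ u v u 0 0 v"
  obtains m n where "table cdot u v (smul n u) 0 0 (smul m v)"
proof -
  have C: "table circ u v (combo u v 1 0) (combo u v 0 0) (combo u v 0 0) (combo u v 0 1)"
    using T by (simp add: table_def combo_def)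
  obtain a b c d f g where D:
    "table cdot u v (combo u v a b) (combo u v c d) (combo u v c d) (combo u v f g)"
    using uv by (rule dot_table)
  note compute = mul_combo[OF C] dot.mul_combo[OF D] combo_add combo_scale frame_eq_iff[OF uv]
  have "b = 0" "c = 0" "d = 0" "f = 0"
    using dot_circ[of "combo u v 1 0" "combo u v 1 0" "combo u v 0 1"]
      dot_circ[of "combo u v 0 1" "combo u v 1 0" "combo u v 0 1"] by (simp_all add: compute)
  then have "table cdot u v (smul a u) 0 0 (smul g v)"
    using D by (simp add: table_def combo_def)
  then show thesis by (rule that)
qed

text \<open>Right multiplication by \<open>u\<close> vanishes, so \<open>dot_circ\<close> confines
  \<open>cdot x u\<close> to the line of \<open>u\<close>; the transposed Leibniz rule for
  \<open>circ v v = v\<close> confines \<open>cdot z v\<close> to the line of \<open>v\<close>.\<close>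

lemma dot_of_N2:
  assumes uv: "frame u v" and T: "table circ u v 0 0 0 v"
  obtains m n where "table cdot u v (smul n u) 0 0 (smul m v)"
proof -
  have C: "table circ u v (combo u v 0 0) (combo u v 0 0) (combo u v 0 0) (combo u v 0 1)"
    using T by (simp add: table_def combo_def)
  obtain a b c d f g where D:
    "table cdot u v (combo u v a b) (combo u v c d) (combo u v c d) (combo u v f g)"
    using uv by (rule dot_table)
  note compute = mul_combo[OF C] dot.mul_combo[OF D] combo_add combo_scale frame_eq_iff[OF uv]
  have "b = 0" "d = 0"
    using dot_circ[of "combo u v 1 0" "combo u v 1 0" "combo u v 0 1"]
      dot_circ[of "combo u v 0 1" "combo u v 1 0" "combo u v 0 1"] by (simp_all add: compute)
  moreover have "c = 0"
    using transposed_leibniz[of "combo u v 1 0" "combo u v 0 1" "combo u v 0 1"]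
    by (simp add: compute)
  moreover have "f = 0"
    using transposed_leibniz[of "combo u v 0 1" "combo u v 0 1" "combo u v 0 1"]
    by (simp add: compute)
  ultimately have "table cdot u v (smul a u) 0 0 (smul g v)"
    using D by (simp add: table_def combo_def)
  then show thesis by (rule that)
qed

text \<open>Right multiplication by \<open>v\<close> is the identity, so \<open>dot_circ\<close>
  expresses \<open>cdot x u\<close> as \<open>l\<close> times the \<open>v\<close>-coordinate of
  \<open>cdot x v\<close>, times \<open>u\<close>. With the transposed Leibniz rule, both
  parameters \<open>m\<close> and \<open>n\<close> are fixed under multiplication by
  \<open>l\<close>, so they survive only for \<open>l = 1\<close>.\<close>

lemma dot_of_N346:
  assumes uv: "frame u v" and T: "table circ u v 0 u (smul l u) v"
  obtains m n where "table cdot u v 0 (smul n u) (smul n u) (smul m u + smul n v)"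
    and "l = 1 \<or> m = 0 \<and> n = 0"
proof -
  have C: "table circ u v (combo u v 0 0) (combo u v 1 0) (combo u v l 0) (combo u v 0 1)"
    using T by (simp add: table_def combo_def)
  obtain a b c d f g where D:
    "table cdot u v (combo u v a b) (combo u v c d) (combo u v c d) (combo u v f g)"
    using uv by (rule dot_table)
  note compute = mul_combo[OF C] dot.mul_combo[OF D] combo_add combo_scale frame_eq_iff[OF uv]
  have 1: "a = d * l" "b = 0"
    using dot_circ[of "combo u v 1 0" "combo u v 1 0" "combo u v 0 1"] by (simp_all add: compute)
  have 2: "c = g * l" "d = 0"
    using dot_circ[of "combo u v 0 1" "combo u v 1 0" "combo u v 0 1"] by (simp_all add: compute)
  have 3: "c = g"
    using transposed_leibniz[of "combo u v 0 1" "combo u v 1 0" "combo u v 0 1"] 2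
    by (simp add: compute)
  have 4: "f = l * f"
    using transposed_leibniz[of "combo u v 0 1" "combo u v 0 1" "combo u v 0 1"]
    by (simp add: compute)
  have "table cdot u v 0 (smul g u) (smul g u) (smul f u + smul g v)"
    using D 1 2(2) 3 by (simp add: table_def combo_def)
  moreover have "l = 1 \<or> f = 0 \<and> g = 0"
    using 2 3 4 by auto
  ultimately show thesis by (rule that)
qed

text \<open>Right multiplication by \<open>u\<close> vanishes while the one by \<open>v\<close> is
  injective, so \<open>dot_circ\<close> makes \<open>cdot x u\<close> vanish. The transposed
  Leibniz rule for \<open>circ u v = u\<close> and \<open>circ v v = u + v\<close> removes the two
  coordinates of \<open>cdot v v\<close>.\<close>

lemma dot_of_N5:
  assumes uv: "frame u v" and T: "table circ u v 0 u 0 (u + v)"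
  shows "table cdot u v 0 0 0 0"
proof -
  have C: "table circ u v (combo u v 0 0) (combo u v 1 0) (combo u v 0 0) (combo u v 1 1)"
    using T by (simp add: table_def combo_def)
  obtain a b c d f g where D:
    "table cdot u v (combo u v a b) (combo u v c d) (combo u v c d) (combo u v f g)"
    using uv by (rule dot_table)
  note compute = mul_combo[OF C] dot.mul_combo[OF D] combo_add combo_scale frame_eq_iff[OF uv]
  have bd: "b = 0" "d = 0"
    using dot_circ[of "combo u v 1 0" "combo u v 1 0" "combo u v 0 1"]
      dot_circ[of "combo u v 0 1" "combo u v 1 0" "combo u v 0 1"] by (simp_all add: compute)
  then have 1: "a = 0" "b = 0" "c = 0" "d = 0"
    using dot_circ[of "combo u v 1 0" "combo u v 1 0" "combo u v 0 1"]
      dot_circ[of "combo u v 0 1" "combo u v 1 0" "combo u v 0 1"] by (simp_all add: compute)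
  have 2: "g = 0"
    using transposed_leibniz[of "combo u v 0 1" "combo u v 1 0" "combo u v 0 1"] 1
    by (simp add: compute)
  have "f = 0"
    using transposed_leibniz[of "combo u v 0 1" "combo u v 0 1" "combo u v 0 1"] 1 2
    by (simp add: compute)
  then show ?thesis
    using D 1 2 by (simp add: table_def combo_def)
qed

section \<open>Passage to matrices\<close>

text \<open>The isomorphism is the coordinate map of the frame; its inverse
  \<open>\<kappa>\<close> is the one with an explicit formula, so equations are transported
  through \<open>\<kappa>\<close>.\<close>

lemma isomorphic_to_matricesI:
  fixes u v defines "\<kappa> \<equiv> \<lambda>w :: complex ^ 2. combo u v (w $ 1) (w $ 2)"
  assumes uv: "frame u v"
    and "table circ u v (\<kappa> A) (\<kappa> B) (\<kappa> C) (\<kappa> D)"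
    and "table cdot u v (\<kappa> A') (\<kappa> B') (\<kappa> C') (\<kappa> D')"
  shows "isomorphic_to_matrices smul cdot circ (matrix2 A B C D) (matrix2 A' B' C' D')"
proof -
  have op: "\<kappa> (operation_of_matrix (matrix2 P Q R S) x y) = mul (\<kappa> x) (\<kappa> y)"
    if "bilinear_operation smul mul" "table mul u v (\<kappa> P) (\<kappa> Q) (\<kappa> R) (\<kappa> S)"
    for mul P Q R S x y
  proof -
    interpret mul: bilinear_operation smul mul by fact
    show ?thesis
      using mul.mul_combo[OF that(2)[unfolded \<kappa>_def]]
      by (simp add: \<kappa>_def operation_of_matrix_def matrix2_def sum_2 algebra_simps)
  qed
  have "bij \<kappa>"
  proof (rule bijI)
    show "inj \<kappa>"
      by (rule injI) (simp add: \<kappa>_def frame_eq_iff[OF uv] vec_eq_iff forall_2)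
    show "surj \<kappa>"
    proof (rule surjI)
      fix x
      show "\<kappa> (SOME w. \<kappa> w = x) = x"
      proof (rule someI_ex)
        obtain a b where "x = combo u v a b" using uv by (rule frame_obtain)
        then have "\<kappa> (vector [a, b]) = x" by (simp add: \<kappa>_def)
        then show "\<exists>w. \<kappa> w = x" ..
      qed
    qed
  qed
  define f where "f = inv \<kappa>"
  have f_\<kappa>: "f (\<kappa> w) = w" for w
    using \<open>bij \<kappa>\<close> by (simp add: f_def bij_is_inj)
  have \<kappa>_f: "\<kappa> (f x) = x" for x
    using \<open>bij \<kappa>\<close> by (simp add: f_def bij_is_surj surj_f_inv_f)
  have transfer: "f x = w \<longleftrightarrow> x = \<kappa> w" for x w
    using f_\<kappa> \<kappa>_f by metis
  have \<kappa>_add: "\<kappa> (w + w') = \<kappa> w + \<kappa> w'" and \<kappa>_scale: "\<kappa> (k *s w) = smul k (\<kappa> w)" for w w' k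
    by (simp_all add: \<kappa>_def combo_add combo_scale)
  have "Vector_Spaces.linear smul (*s) f"
    using vector_space_axioms vec.vector_space_axioms
    by (simp add: Vector_Spaces.linear_iff transfer \<kappa>_add \<kappa>_scale \<kappa>_f)
  moreover have "bij f" using \<open>bij \<kappa>\<close> unfolding f_def by (rule bij_imp_bij_inv)
  moreover have "f (circ x y) = operation_of_matrix (matrix2 A B C D) (f x) (f y)" for x y
    by (simp add: transfer op[OF bilinear_operation_axioms assms(3)] \<kappa>_f)
  moreover have "f (cdot x y) = operation_of_matrix (matrix2 A' B' C' D') (f x) (f y)" for x y
    by (simp add: transfer op[OF dot.bilinear_operation_axioms assms(4)] \<kappa>_f)
  ultimately show ?thesis
    unfolding isomorphic_to_matrices_def isomorphic_algebras_def by blast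
qed

end

section \<open>The classification\<close>

theorem proposition2p21:
  fixes smul :: "complex \<Rightarrow> 'a::ab_group_add \<Rightarrow> 'a"
    and cdot circ :: "'a \<Rightarrow> 'a \<Rightarrow> 'a"
  assumes "transposed_novikov_poisson_algebra smul cdot circ"
    and "vector_space.dim smul (UNIV :: 'a set) = 2"
    and "\<exists>x y. circ x y \<noteq> 0"
  shows
    "(\<exists>m n. isomorphic_to_matrices smul cdot circ
        (matrix2 0 0
                 0 e1)
        (matrix2 0         (m *s e1)
                 (m *s e1) (n *s e1 + m *s e2))) \<or>
     isomorphic_to_matrices smul cdot circ
        (matrix2 0     0
                 (-e1) 0)
        (matrix2 0 0
                 0 0) \<or>
     (\<exists>m n. isomorphic_to_matrices smul cdot circ
        (matrix2 e1 0
                 0  e2)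
        (matrix2 (n *s e1) 0
                 0         (m *s e2))) \<or>
     (\<exists>m n. isomorphic_to_matrices smul cdot circ
        (matrix2 0 0
                 0 e2)
        (matrix2 (n *s e1) 0
                 0         (m *s e2))) \<or>
     (\<exists>m n. isomorphic_to_matrices smul cdot circ
        (matrix2 0  e1
                 e1 e2)
        (matrix2 0         (n *s e1)
                 (n *s e1) (m *s e1 + n *s e2))) \<or>
     isomorphic_to_matrices smul cdot circ
        (matrix2 0 e1
                 0 e2)
        (matrix2 0 0
                 0 0) \<or>
     isomorphic_to_matrices smul cdot circ
        (matrix2 0 e1
                 0 (e1 + e2))
        (matrix2 0 0
                 0 0) \<or>
     (\<exists>l. l \<noteq> 0 \<and> l \<noteq> 1 \<and> isomorphic_to_matrices smul cdot circ
        (matrix2 0         e1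
                 (l *s e1) e2)
        (matrix2 0 0
                 0 0))"
proof -
  interpret complex_transposed_novikov_poisson_algebra smul cdot circ
    using assms(1)
    by (simp add: complex_transposed_novikov_poisson_algebra_def complex_novikov_algebra_def
        transposed_novikov_poisson_algebra_def)
  obtain p q where pq: "frame p q"
    using assms(2) by (rule frame_exists)
  from pq assms(3) show ?thesis
  proof (cases rule: normal_forms)
    case (T2 u v)
    obtain m n where "table cdot u v 0 (smul m u) (smul m u) (smul n u + smul m v)"
      using T2 by (rule dot_of_T2)
    then have "isomorphic_to_matrices smul cdot circ (matrix2 0 0 0 e1)
        (matrix2 0 (m *s e1) (m *s e1) (n *s e1 + m *s e2))"
      using T2 by (intro isomorphic_to_matricesI) (auto simp: combo_def axis_def)
    then show ?thesis by blast
  next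
    case (T3 u v)
    have "isomorphic_to_matrices smul cdot circ (matrix2 0 0 (- e1) 0) (matrix2 0 0 0 0)"
      using T3 dot_of_T3[OF T3] by (intro isomorphic_to_matricesI) (auto simp: combo_def axis_def)
    then show ?thesis by blast
  next
    case (N1 u v)
    obtain m n where "table cdot u v (smul n u) 0 0 (smul m v)"
      using N1 by (rule dot_of_N1)
    then have "isomorphic_to_matrices smul cdot circ (matrix2 e1 0 0 e2)
        (matrix2 (n *s e1) 0 0 (m *s e2))"
      using N1 by (intro isomorphic_to_matricesI) (auto simp: combo_def axis_def)
    then show ?thesis by blast
  next
    case (N2 u v)
    obtain m n where "table cdot u v (smul n u) 0 0 (smul m v)"
      using N2 by (rule dot_of_N2)
    then have "isomorphic_to_matrices smul cdot circ (matrix2 0 0 0 e2)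
        (matrix2 (n *s e1) 0 0 (m *s e2))"
      using N2 by (intro isomorphic_to_matricesI) (auto simp: combo_def axis_def)
    then show ?thesis by blast
  next
    case (N346 u v l)
    obtain m n where D: "table cdot u v 0 (smul n u) (smul n u) (smul m u + smul n v)"
      and mn: "l = 1 \<or> m = 0 \<and> n = 0"
      using N346 by (rule dot_of_N346)
    have iso: "isomorphic_to_matrices smul cdot circ (matrix2 0 e1 (l *s e1) e2)
        (matrix2 0 (n *s e1) (n *s e1) (m *s e1 + n *s e2))"
      using N346 D by (intro isomorphic_to_matricesI) (auto simp: combo_def axis_def)
    consider "l = 1" | "l = 0" | "l \<noteq> 0" "l \<noteq> 1" by blast
    then show ?thesis
    proof cases
      case 1
      with iso have "isomorphic_to_matrices smul cdot circ (matrix2 0 e1 e1 e2)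
          (matrix2 0 (n *s e1) (n *s e1) (m *s e1 + n *s e2))" by simp
      then show ?thesis by blast
    next
      case 2
      with iso mn have "isomorphic_to_matrices smul cdot circ (matrix2 0 e1 0 e2)
          (matrix2 0 0 0 0)" by simp
      then show ?thesis by blast
    next
      case 3
      with iso mn have "isomorphic_to_matrices smul cdot circ (matrix2 0 e1 (l *s e1) e2)
          (matrix2 0 0 0 0)" by simp
      with 3 show ?thesis by blast
    qed
  next
    case (N5 u v)
    have "isomorphic_to_matrices smul cdot circ (matrix2 0 e1 0 (e1 + e2)) (matrix2 0 0 0 0)"
      using N5 dot_of_N5[OF N5] by (intro isomorphic_to_matricesI) (auto simp: combo_def axis_def)
    then show ?thesis by blast
  qed
qed

end
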